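(* Let $V$ be a $\mathbb{K}$-vector space with $\mathbb{K}=\mathbb{R}$ or $\mathbb{C}$, and let $\mathcal F=\{\langle\cdot,\cdot\rangle_i\}_{i\in I}$ be a bounded family of inner products on $V$, with associated inner product $\langle\!\langle\!\langle x,y\rangle\!\rangle\!\rangle=\mathrm{st}(\langle\!\langle x,y\rangle\!\rangle)$. Then: (i) $\mathrm{rad}(\langle\!\langle\!\langle\cdot,\cdot\rangle\!\rangle\!\rangle)=\mathrm{neg}_{\mathcal F}(V)$. (ii) If $\mathcal F$ is robust, the inner product $\langle\!\langle\!\langle\cdot,\cdot\rangle\!\rangle\!\rangle$ is nondegenerate. (iii) $\mathcal F$ is simultaneously orthogonalizable if and only if the enlarged family $\mathcal F\cup\{\langle\!\langle\!\langle\cdot,\cdot\rangle\!\rangle\!\rangle\}$ is simultaneously orthogonalizable. Furthermore, if $\mathcal F$ is robust and simultaneously orthogonalizable, the enlarged family $\mathcal F\cup\{\langle\!\langle\!\langle\cdot,\cdot\rangle\!\rangle\!\rangle\}$ is nondegenerate. (iv) The simultaneous orthogonalizations of $V$ relative to $\mathcal F$ and to $\mathcal F\cup\{\langle\!\langle\!\langle\cdot,\cdot\rangle\!\rangle\!\rangle\}$ agree; that is, a basis of $V$ is orthogonal relative to every element of $\mathcal F$ if and only if it is orthogonal relative to every element of $\mathcal F\cup\{\langle\!\langle\!\langle\cdot,\cdot\rangle\!\rangle\!\rangle\}$.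
   Context: An inner product on a $\mathbb{K}$-vector space $V$ is a symmetric $\mathbb{K}$-bilinear form $V\times V\to\mathbb{K}$ (also when $\mathbb{K}=\mathbb{C}$); its radical is $\{x\in V\colon\langle x,V\rangle=0\}$, and it is nondegenerate if its radical is $0$. A family of inner products is simultaneously orthogonalizable if there is a basis $\{v_j\}$ of $V$ with $\langle v_j,v_k\rangle=0$ for every member of the family and all $j\ne k$. For a nondegenerate inner product, the $\langle\cdot,\cdot\rangle$-topology of $V$ is the one in which a basis of neighborhoods of $x\in V$ is given by the sets $x+\bigcap_{k=1}^n v_k^\perp$, with $v_1,\dots,v_n$ a finite collection in $V$ and $v^\perp=\{x\in V\colon\langle x,v\rangle=0\}$. Here $\mathbb{K}$ carries the discrete topology. A map $B\colon X\times X\to Y$ is partially continuous if $B(x,\_)$ and $B(\_,x)$ are continuous for every $x\in X$. A family of inner products is nondegenerate if it contains an element $\langle\cdot,\cdot\rangle_0$ with zero radical such that every element of the family is partially continuous relative to the $\langle\cdot,\cdot\rangle_0$-topology. The index set $I$ is assumed to be a directed set for some preorder $\le$ (no loss of generality, e.g. by well-ordering $I$). $\mathfrak U$ is a fixed ultrafilter on $I$ containing all the sets $[i,\to):=\{j\in I\colon i\le j\}$, $i\in I$. ${}^*\mathbb{K}=\mathbb{K}^I/\mathfrak U$ is the ultrapower field, with elements $[(x_i)]$; ${}^*\mathbb{R}$ is ordered by $[(x_i)]<[(y_i)]$ iff $\{i\colon x_i<y_i\}\in\mathfrak U$, and $|[(x_i)]|:=[(|x_i|)]\in{}^*\mathbb{R}$.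 An element $x\in{}^*\mathbb{K}$ is finite if $|x|<M$ for some real $M$, and infinitesimal if $|x|<\epsilon$ for all real $\epsilon>0$. Every finite $x\in{}^*\mathbb{K}$ is uniquely $x=\mathrm{st}(x)+w$ with $\mathrm{st}(x)\in\mathbb{K}$ and $w$ infinitesimal. $\mathcal F$ is bounded if for all $x,y\in V$ there is $M\in\mathbb{R}$ with $\{i\in I\colon|\langle x,y\rangle_i|<M\}\in\mathfrak U$. An element $x\in V$ is negligible if for every $y\in V$ and every real $\epsilon>0$, $\{i\in I\colon|\langle x,y\rangle_i|<\epsilon\}\in\mathfrak U$; the set of negligible elements is $\mathrm{neg}_{\mathcal F}(V)$, and $\mathcal F$ is robust if $\mathrm{neg}_{\mathcal F}(V)=0$. Put $\langle\!\langle x,y\rangle\!\rangle:=[(\langle x,y\rangle_i)_{i\in I}]\in{}^*\mathbb{K}$, which is finite for all $x,y$ when $\mathcal F$ is bounded; in that case $\langle\!\langle\!\langle\cdot,\cdot\rangle\!\rangle\!\rangle\colon V\times V\to\mathbb{K}$ is the inner product $\langle\!\langle\!\langle x,y\rangle\!\rangle\!\rangle:=\mathrm{st}(\langle\!\langle x,y\rangle\!\rangle)$. *)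

theory Defs
  imports "HOL-Analysis.Analysis"
begin

section \<open>The scalar field\<close>

text \<open>
  The members of this class are, up to isometric isomorphism, exactly the fields \<open>\<real>\<close> and \<open>\<complex>\<close> with
  their usual absolute values; both concrete types are instances.
\<close>

class real_or_complex = real_normed_field +
  assumes isometric_real_or_complex:
    "\<exists>\<phi> :: 'a \<Rightarrow> complex.
       (\<forall>x y. \<phi> (x + y) = \<phi> x + \<phi> y) \<and> (\<forall>x y. \<phi> (x * y) = \<phi> x * \<phi> y) \<and>
       (\<forall>r. \<phi> (scaleR r 1) = of_real r) \<and> (\<forall>x. norm (\<phi> x) = norm x) \<and>
       (range \<phi> = \<real> \<or> range \<phi> = UNIV)"

instance real :: real_or_complex
proof
  show "\<exists>\<phi> :: real \<Rightarrow> complex.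
       (\<forall>x y. \<phi> (x + y) = \<phi> x + \<phi> y) \<and> (\<forall>x y. \<phi> (x * y) = \<phi> x * \<phi> y) \<and>
       (\<forall>r. \<phi> (scaleR r 1) = of_real r) \<and> (\<forall>x. norm (\<phi> x) = norm x) \<and>
       (range \<phi> = \<real> \<or> range \<phi> = UNIV)"
    by (rule exI[of _ complex_of_real]) (simp add: Reals_def)
qed

instance complex :: real_or_complex
proof
  show "\<exists>\<phi> :: complex \<Rightarrow> complex.
       (\<forall>x y. \<phi> (x + y) = \<phi> x + \<phi> y) \<and> (\<forall>x y. \<phi> (x * y) = \<phi> x * \<phi> y) \<and>
       (\<forall>r. \<phi> (scaleR r 1) = of_real r) \<and> (\<forall>x. norm (\<phi> x) = norm x) \<and>
       (range \<phi> = \<real> \<or> range \<phi> = UNIV)"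
    by (rule exI[of _ id]) (simp add: of_real_def)
qed


section \<open>Inner products\<close>

definition inner_product :: "('k::field \<Rightarrow> 'v::ab_group_add \<Rightarrow> 'v) \<Rightarrow> ('v \<Rightarrow> 'v \<Rightarrow> 'k) \<Rightarrow> bool" where
  "inner_product smul B \<longleftrightarrow>
     (\<forall>x y. B x y = B y x) \<and>
     (\<forall>x. Vector_Spaces.linear smul (*) (B x)) \<and>
     (\<forall>y. Vector_Spaces.linear smul (*) (\<lambda>x. B x y))"

definition form_radical :: "('v \<Rightarrow> 'v \<Rightarrow> 'k::zero) \<Rightarrow> 'v set" where
  "form_radical B = {x. \<forall>y. B x y = 0}"

definition nondegenerate :: "('v::zero \<Rightarrow> 'v \<Rightarrow> 'k::zero) \<Rightarrow> bool" where
  "nondegenerate B \<longleftrightarrow> form_radical B = {0}"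

definition is_basis :: "('k::field \<Rightarrow> 'v::ab_group_add \<Rightarrow> 'v) \<Rightarrow> 'v set \<Rightarrow> bool" where
  "is_basis smul S \<longleftrightarrow> \<not> module.dependent smul S \<and> module.span smul S = UNIV"

definition orthogonal_wrt :: "('v \<Rightarrow> 'v \<Rightarrow> 'k::zero) \<Rightarrow> 'v set \<Rightarrow> bool" where
  "orthogonal_wrt B S \<longleftrightarrow> (\<forall>v\<in>S. \<forall>w\<in>S. v \<noteq> w \<longrightarrow> B v w = 0)"

definition simultaneously_orthogonalizable ::
  "('k::field \<Rightarrow> 'v::ab_group_add \<Rightarrow> 'v) \<Rightarrow> ('v \<Rightarrow> 'v \<Rightarrow> 'k) set \<Rightarrow> bool" where
  "simultaneously_orthogonalizable smul \<F> \<longleftrightarrow>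
     (\<exists>S. is_basis smul S \<and> (\<forall>B\<in>\<F>. orthogonal_wrt B S))"


section \<open>The topology of an inner product\<close>

definition orth_complement :: "('v \<Rightarrow> 'v \<Rightarrow> 'k::zero) \<Rightarrow> 'v \<Rightarrow> 'v set" where
  "orth_complement B v = {x. B x v = 0}"

definition form_topology :: "('v::plus \<Rightarrow> 'v \<Rightarrow> 'k::zero) \<Rightarrow> 'v topology" where
  "form_topology B =
     topology (\<lambda>S. \<forall>x\<in>S. \<exists>A. finite A \<and> (+) x ` (\<Inter>v\<in>A. orth_complement B v) \<subseteq> S)"

lemma openin_form_topology:
  "openin (form_topology B) S \<longleftrightarrow>
     (\<forall>x\<in>S. \<exists>A. finite A \<and> (+) x ` (\<Inter>v\<in>A. orth_complement B v) \<subseteq> S)"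
proof -
  let ?N = "\<lambda>A x. (+) x ` (\<Inter>v\<in>A. orth_complement B v)"
  let ?P = "\<lambda>S. \<forall>x\<in>S. \<exists>A. finite A \<and> ?N A x \<subseteq> S"
  have "?P (S \<inter> T)" if S: "?P S" and T: "?P T" for S T
  proof
    fix x assume x: "x \<in> S \<inter> T"
    obtain A where A: "finite A" "?N A x \<subseteq> S" using S x by (meson IntD1)
    obtain A' where A': "finite A'" "?N A' x \<subseteq> T" using T x by (meson IntD2)
    have "?N (A \<union> A') x \<subseteq> S \<inter> T"
    proof (rule Int_greatest)
      show "?N (A \<union> A') x \<subseteq> S"
        by (rule order_trans[OF image_mono A(2)]) (rule INF_superset_mono, simp_all)
      show "?N (A \<union> A') x \<subseteq> T"
        by (rule order_trans[OF image_mono A'(2)]) (rule INF_superset_mono, simp_all)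
    qed
    then show "\<exists>A. finite A \<and> ?N A x \<subseteq> S \<inter> T"
      using A(1) A'(1) by (intro exI[of _ "A \<union> A'"]) simp
  qed
  moreover have "?P (\<Union>\<K>)" if "\<forall>K\<in>\<K>. ?P K" for \<K>
    using that by (meson Union_upper UnionE order_trans)
  ultimately have "istopology ?P"
    unfolding istopology_def by (intro conjI allI impI)
  then show ?thesis
    unfolding form_topology_def by (simp only: topology_inverse')
qed

definition partially_continuous :: "'x topology \<Rightarrow> 'y topology \<Rightarrow> ('x \<Rightarrow> 'x \<Rightarrow> 'y) \<Rightarrow> bool" where
  "partially_continuous X Y B \<longleftrightarrow>
     (\<forall>x\<in>topspace X. continuous_map X Y (B x) \<and> continuous_map X Y (\<lambda>y. B y x))"

definition nondegenerate_family :: "('v::{plus,zero} \<Rightarrow> 'v \<Rightarrow> 'k::zero) set \<Rightarrow> bool" where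
  "nondegenerate_family \<F> \<longleftrightarrow>
     (\<exists>B\<^sub>0\<in>\<F>. nondegenerate B\<^sub>0 \<and>
       (\<forall>B\<in>\<F>. partially_continuous (form_topology B\<^sub>0) (discrete_topology UNIV) B))"


section \<open>Ultrapowers\<close>

text \<open>
  A set \<open>{i. P i}\<close> belongs to an ultrafilter \<open>\<UU>\<close> iff \<open>eventually P \<UU>\<close>.  Filters in the library may be
  improper, hence the condition \<open>\<UU> \<noteq> bot\<close>.
\<close>

definition ultrafilter :: "'i filter \<Rightarrow> bool" where
  "ultrafilter \<UU> \<longleftrightarrow> \<UU> \<noteq> bot \<and> (\<forall>P. eventually P \<UU> \<or> eventually (\<lambda>i. \<not> P i) \<UU>)"

definition directed_preorder :: "('i \<Rightarrow> 'i \<Rightarrow> bool) \<Rightarrow> bool" where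
  "directed_preorder le \<longleftrightarrow> reflp le \<and> transp le \<and> (\<forall>i j. \<exists>k. le i k \<and> le j k)"

definition ultra_rel :: "'i filter \<Rightarrow> (('i \<Rightarrow> 'a) \<times> ('i \<Rightarrow> 'a)) set" where
  "ultra_rel \<UU> = {(x, y). eventually (\<lambda>i. x i = y i) \<UU>}"

definition ultra_class :: "'i filter \<Rightarrow> ('i \<Rightarrow> 'a) \<Rightarrow> ('i \<Rightarrow> 'a) set" where
  "ultra_class \<UU> x = ultra_rel \<UU> `` {x}"

definition ultrapower :: "'i filter \<Rightarrow> ('i \<Rightarrow> 'a) set set" where
  "ultrapower \<UU> = UNIV // ultra_rel \<UU>"

definition ultra_const :: "'i filter \<Rightarrow> 'a \<Rightarrow> ('i \<Rightarrow> 'a) set" where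
  "ultra_const \<UU> c = ultra_class \<UU> (\<lambda>_. c)"

definition ultra_add :: "'i filter \<Rightarrow> ('i \<Rightarrow> 'a::plus) set \<Rightarrow> ('i \<Rightarrow> 'a) set \<Rightarrow> ('i \<Rightarrow> 'a) set" where
  "ultra_add \<UU> X Y = (\<Union>x\<in>X. \<Union>y\<in>Y. ultra_class \<UU> (\<lambda>i. x i + y i))"

definition ultra_abs :: "'i filter \<Rightarrow> ('i \<Rightarrow> 'a::real_normed_vector) set \<Rightarrow> ('i \<Rightarrow> real) set" where
  "ultra_abs \<UU> X = (\<Union>x\<in>X. ultra_class \<UU> (\<lambda>i. norm (x i)))"

definition ultra_less :: "'i filter \<Rightarrow> ('i \<Rightarrow> real) set \<Rightarrow> ('i \<Rightarrow> real) set \<Rightarrow> bool" where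
  "ultra_less \<UU> X Y \<longleftrightarrow> (\<exists>x\<in>X. \<exists>y\<in>Y. eventually (\<lambda>i. x i < y i) \<UU>)"

lemma mem_ultra_class: "y \<in> ultra_class \<UU> x \<longleftrightarrow> eventually (\<lambda>i. x i = y i) \<UU>"
  by (simp add: ultra_class_def ultra_rel_def)

lemma equiv_ultra_rel: "equiv UNIV (ultra_rel \<UU>)"
proof (rule equivI)
  show "refl (ultra_rel \<UU>)" by (simp add: ultra_rel_def refl_on_def)
  show "sym (ultra_rel \<UU>)" by (auto simp: ultra_rel_def sym_def eq_commute)
  show "trans (ultra_rel \<UU>)"
    by (auto simp: ultra_rel_def trans_def elim: eventually_elim2)
qed auto

lemma ultra_class_eq_iff:
  "ultra_class \<UU> x = ultra_class \<UU> y \<longleftrightarrow> eventually (\<lambda>i. x i = y i) \<UU>"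
  using eq_equiv_class_iff[OF equiv_ultra_rel, of x y \<UU>]
  by (simp add: ultra_class_def ultra_rel_def)

lemma ultra_class_in_ultrapower: "ultra_class \<UU> x \<in> ultrapower \<UU>"
  by (simp add: ultra_class_def ultrapower_def quotientI)

lemma ultrapower_cases:
  assumes "X \<in> ultrapower \<UU>"
  obtains x where "X = ultra_class \<UU> x"
  using assms by (auto simp: ultra_class_def ultrapower_def elim: quotientE)

lemma ultra_add_class:
  "ultra_add \<UU> (ultra_class \<UU> x) (ultra_class \<UU> y) = ultra_class \<UU> (\<lambda>i. x i + y i)"
proof -
  have "ultra_class \<UU> (\<lambda>i. x' i + y' i) = ultra_class \<UU> (\<lambda>i. x i + y i)"
    if "x' \<in> ultra_class \<UU> x" "y' \<in> ultra_class \<UU> y" for x' y'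
    using that unfolding ultra_class_eq_iff mem_ultra_class by eventually_elim simp
  moreover have "x \<in> ultra_class \<UU> x" "y \<in> ultra_class \<UU> y"
    by (simp_all add: mem_ultra_class)
  ultimately show ?thesis unfolding ultra_add_def by blast
qed

lemma ultra_abs_class: "ultra_abs \<UU> (ultra_class \<UU> x) = ultra_class \<UU> (\<lambda>i. norm (x i))"
proof -
  have "ultra_class \<UU> (\<lambda>i. norm (x' i)) = ultra_class \<UU> (\<lambda>i. norm (x i))"
    if "x' \<in> ultra_class \<UU> x" for x'
    using that unfolding ultra_class_eq_iff mem_ultra_class by eventually_elim simp
  moreover have "x \<in> ultra_class \<UU> x" by (simp add: mem_ultra_class)
  ultimately show ?thesis unfolding ultra_abs_def by blast
qed

lemma ultra_less_class:
  "ultra_less \<UU> (ultra_class \<UU> x) (ultra_class \<UU> y) \<longleftrightarrow> eventually (\<lambda>i. x i < y i) \<UU>"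
proof
  assume "ultra_less \<UU> (ultra_class \<UU> x) (ultra_class \<UU> y)"
  then obtain x' y' where "eventually (\<lambda>i. x i = x' i) \<UU>" "eventually (\<lambda>i. y i = y' i) \<UU>"
    "eventually (\<lambda>i. x' i < y' i) \<UU>"
    by (auto simp: ultra_less_def mem_ultra_class)
  then show "eventually (\<lambda>i. x i < y i) \<UU>" by eventually_elim simp
qed (force simp: ultra_less_def mem_ultra_class)

definition ultra_finite :: "'i filter \<Rightarrow> ('i \<Rightarrow> 'a::real_normed_vector) set \<Rightarrow> bool" where
  "ultra_finite \<UU> X \<longleftrightarrow> (\<exists>M. ultra_less \<UU> (ultra_abs \<UU> X) (ultra_const \<UU> M))"

definition ultra_infinitesimal :: "'i filter \<Rightarrow> ('i \<Rightarrow> 'a::real_normed_vector) set \<Rightarrow> bool" where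
  "ultra_infinitesimal \<UU> X \<longleftrightarrow> (\<forall>\<epsilon>>0. ultra_less \<UU> (ultra_abs \<UU> X) (ultra_const \<UU> \<epsilon>))"

text \<open>The standard part is meaningful only for finite elements, where it exists uniquely
  (see \<open>ex1_standard_part\<close> below); its value elsewhere is unspecified.\<close>

definition standard_part :: "'i filter \<Rightarrow> ('i \<Rightarrow> 'a::real_normed_vector) set \<Rightarrow> 'a" where
  "standard_part \<UU> X =
     (THE s. \<exists>W\<in>ultrapower \<UU>. ultra_infinitesimal \<UU> W \<and> X = ultra_add \<UU> (ultra_const \<UU> s) W)"


section \<open>Families of inner products indexed by a directed set\<close>

definition bounded_family :: "'i filter \<Rightarrow> ('i \<Rightarrow> 'v \<Rightarrow> 'v \<Rightarrow> 'k::real_normed_vector) \<Rightarrow> bool" where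
  "bounded_family \<UU> B \<longleftrightarrow> (\<forall>x y. \<exists>M. eventually (\<lambda>i. norm (B i x y) < M) \<UU>)"

definition neg_elements :: "'i filter \<Rightarrow> ('i \<Rightarrow> 'v \<Rightarrow> 'v \<Rightarrow> 'k::real_normed_vector) \<Rightarrow> 'v set" where
  "neg_elements \<UU> B = {x. \<forall>y. \<forall>\<epsilon>>0. eventually (\<lambda>i. norm (B i x y) < \<epsilon>) \<UU>}"

definition robust_family ::
  "'i filter \<Rightarrow> ('i \<Rightarrow> 'v::zero \<Rightarrow> 'v \<Rightarrow> 'k::real_normed_vector) \<Rightarrow> bool" where
  "robust_family \<UU> B \<longleftrightarrow> neg_elements \<UU> B = {0}"

definition ultra_form ::
  "'i filter \<Rightarrow> ('i \<Rightarrow> 'v \<Rightarrow> 'v \<Rightarrow> 'k) \<Rightarrow> 'v \<Rightarrow> 'v \<Rightarrow> ('i \<Rightarrow> 'k) set" where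
  "ultra_form \<UU> B x y = ultra_class \<UU> (\<lambda>i. B i x y)"

definition standard_form ::
  "'i filter \<Rightarrow> ('i \<Rightarrow> 'v \<Rightarrow> 'v \<Rightarrow> 'k::real_normed_vector) \<Rightarrow> 'v \<Rightarrow> 'v \<Rightarrow> 'k" where
  "standard_form \<UU> B x y = standard_part \<UU> (ultra_form \<UU> B x y)"


subsection \<open>Well-definedness of the standard part and of the associated inner product\<close>

lemma standard_decomposition_iff:
  fixes x :: "'i \<Rightarrow> 'a::real_normed_vector"
  shows "(\<exists>W\<in>ultrapower \<UU>. ultra_infinitesimal \<UU> W \<and>
            ultra_class \<UU> x = ultra_add \<UU> (ultra_const \<UU> s) W) \<longleftrightarrow> (x \<longlongrightarrow> s) \<UU>"
proof
  assume "\<exists>W\<in>ultrapower \<UU>. ultra_infinitesimal \<UU> W \<and>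
            ultra_class \<UU> x = ultra_add \<UU> (ultra_const \<UU> s) W"
  then obtain w where w: "ultra_infinitesimal \<UU> (ultra_class \<UU> w)"
    and eq: "ultra_class \<UU> x = ultra_add \<UU> (ultra_const \<UU> s) (ultra_class \<UU> w)"
    by (metis ultrapower_cases)
  have eq': "eventually (\<lambda>i. x i = s + w i) \<UU>"
    using eq by (simp add: ultra_const_def ultra_add_class ultra_class_eq_iff)
  show "(x \<longlongrightarrow> s) \<UU>"
  proof (rule tendstoI)
    fix e :: real assume "e > 0"
    with w have "eventually (\<lambda>i. norm (w i) < e) \<UU>"
      by (simp add: ultra_infinitesimal_def ultra_abs_class ultra_const_def ultra_less_class)
    with eq' show "eventually (\<lambda>i. dist (x i) s < e) \<UU>"
      by eventually_elim (simp add: dist_norm)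
  qed
next
  assume lim: "(x \<longlongrightarrow> s) \<UU>"
  have "ultra_infinitesimal \<UU> (ultra_class \<UU> (\<lambda>i. x i - s))"
    using tendstoD[OF lim]
    by (simp add: ultra_infinitesimal_def ultra_abs_class ultra_const_def ultra_less_class dist_norm)
  then show "\<exists>W\<in>ultrapower \<UU>. ultra_infinitesimal \<UU> W \<and>
            ultra_class \<UU> x = ultra_add \<UU> (ultra_const \<UU> s) W"
    by (intro bexI[of _ "ultra_class \<UU> (\<lambda>i. x i - s)"])
       (simp_all add: ultra_const_def ultra_add_class ultra_class_in_ultrapower)
qed

lemma bounded_ultrafilter_tendsto:
  fixes x :: "'i \<Rightarrow> 'a::real_or_complex"
  assumes U: "ultrafilter \<UU>" and M: "eventually (\<lambda>i. norm (x i) < M) \<UU>"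
  shows "\<exists>s. (x \<longlongrightarrow> s) \<UU>"
proof -
  obtain \<phi> :: "'a \<Rightarrow> complex" where
    add: "\<And>x y. \<phi> (x + y) = \<phi> x + \<phi> y" and norm: "\<And>x. norm (\<phi> x) = norm x" and
    rng: "range \<phi> = \<real> \<or> range \<phi> = UNIV"
    using isometric_real_or_complex by blast
  have diff: "\<phi> (a - b) = \<phi> a - \<phi> b" for a b
    using add[of "a - b" b] by simp
  have nontriv: "\<UU> \<noteq> bot" using U by (simp add: ultrafilter_def)
  have ev: "eventually (\<lambda>z. z \<in> cball 0 M) (filtermap (\<lambda>i. \<phi> (x i)) \<UU>)"
    using M by (auto simp: eventually_filtermap norm elim: eventually_mono)
  have "filtermap (\<lambda>i. \<phi> (x i)) \<UU> \<noteq> bot"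
    using nontriv by (simp add: filtermap_bot_iff)
  then obtain l where l: "inf (nhds l) (filtermap (\<lambda>i. \<phi> (x i)) \<UU>) \<noteq> bot"
    using compact_cball[of "0::complex" M] ev unfolding compact_filter by blast
  have lim: "((\<lambda>i. \<phi> (x i)) \<longlongrightarrow> l) \<UU>"
  proof (rule topological_tendstoI)
    fix S assume "open S" "l \<in> S"
    show "eventually (\<lambda>i. \<phi> (x i) \<in> S) \<UU>"
    proof (rule ccontr)
      assume "\<not> eventually (\<lambda>i. \<phi> (x i) \<in> S) \<UU>"
      with U have "eventually (\<lambda>i. \<phi> (x i) \<notin> S) \<UU>"
        unfolding ultrafilter_def by blast
      then have "eventually (\<lambda>z. z \<notin> S) (filtermap (\<lambda>i. \<phi> (x i)) \<UU>)"
        by (simp add: eventually_filtermap)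
      moreover have "eventually (\<lambda>z. z \<in> S) (nhds l)"
        using \<open>open S\<close> \<open>l \<in> S\<close> by (rule eventually_nhds_in_open)
      ultimately have "eventually (\<lambda>_. False) (inf (nhds l) (filtermap (\<lambda>i. \<phi> (x i)) \<UU>))"
        unfolding eventually_inf by blast
      with l show False by (simp add: eventually_False)
    qed
  qed
  have "closed (range \<phi>)" using rng by (auto simp: closed_complex_Reals)
  then have "l \<in> range \<phi>"
    by (rule Lim_in_closed_set[OF _ _ nontriv lim]) simp
  then obtain s where s: "l = \<phi> s" by blast
  have "(x \<longlongrightarrow> s) \<UU>"
    using lim unfolding s tendsto_iff dist_norm by (simp add: diff[symmetric] norm)
  then show ?thesis ..
qed

lemma ex1_standard_part:
  fixes X :: "('i \<Rightarrow> 'a::real_or_complex) set"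
  assumes U: "ultrafilter \<UU>" and X: "X \<in> ultrapower \<UU>" and fin: "ultra_finite \<UU> X"
  shows "\<exists>!s. \<exists>W\<in>ultrapower \<UU>. ultra_infinitesimal \<UU> W \<and> X = ultra_add \<UU> (ultra_const \<UU> s) W"
proof -
  obtain x where x: "X = ultra_class \<UU> x" using X by (rule ultrapower_cases)
  have "\<exists>M. eventually (\<lambda>i. norm (x i) < M) \<UU>"
    using fin unfolding x
    by (simp add: ultra_finite_def ultra_abs_class ultra_const_def ultra_less_class)
  then have "\<exists>s. (x \<longlongrightarrow> s) \<UU>" using bounded_ultrafilter_tendsto[OF U] by blast
  moreover have "\<UU> \<noteq> bot" using U by (simp add: ultrafilter_def)
  ultimately show ?thesis
    unfolding x standard_decomposition_iff by (metis tendsto_unique)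
qed

lemma tendsto_standard_form:
  fixes B :: "'i \<Rightarrow> 'v \<Rightarrow> 'v \<Rightarrow> 'k::real_or_complex"
  assumes U: "ultrafilter \<UU>" and bdd: "bounded_family \<UU> B"
  shows "((\<lambda>i. B i x y) \<longlongrightarrow> standard_form \<UU> B x y) \<UU>"
proof -
  have "ultra_finite \<UU> (ultra_form \<UU> B x y)"
    using bdd by (simp add: bounded_family_def ultra_form_def ultra_finite_def ultra_abs_class
        ultra_const_def ultra_less_class)
  then show ?thesis
    using theI'[OF ex1_standard_part[OF U, of "ultra_form \<UU> B x y"]]
    by (simp add: standard_form_def standard_part_def ultra_form_def ultra_class_in_ultrapower
        standard_decomposition_iff)
qed

lemma inner_product_standard_form:
  fixes smul :: "'k::real_or_complex \<Rightarrow> 'v::ab_group_add \<Rightarrow> 'v"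
  assumes U: "ultrafilter \<UU>" and bdd: "bounded_family \<UU> B"
    and B: "\<And>i. inner_product smul (B i)"
  shows "inner_product smul (standard_form \<UU> B)"
proof -
  let ?T = "standard_form \<UU> B"
  note lim = tendsto_standard_form[OF U bdd]
  have nontriv: "\<UU> \<noteq> bot" using U by (simp add: ultrafilter_def)
  have lin: "Vector_Spaces.linear smul (*) (B i x)" for i x
    using B[of i] unfolding inner_product_def by (elim conjE) (erule spec)
  have sym: "B i x y = B i y x" for i x y
    using B[of i] unfolding inner_product_def by (elim conjE) (erule spec2)
  have Tsym: "?T x y = ?T y x" for x y
  proof (rule tendsto_unique[OF nontriv lim])
    show "((\<lambda>i. B i x y) \<longlongrightarrow> ?T y x) \<UU>"
      using lim[of y x] by (simp only: sym[of _ x y])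
  qed
  have add: "?T x (y + z) = ?T x y + ?T x z" for x y z
  proof (rule tendsto_unique[OF nontriv lim])
    show "((\<lambda>i. B i x (y + z)) \<longlongrightarrow> ?T x y + ?T x z) \<UU>"
      using tendsto_add[OF lim[of x y] lim[of x z]]
      by (simp add: module_hom.add[OF Vector_Spaces.linear.axioms(3)[OF lin]])
  qed
  have mult: "?T x (smul c y) = c * ?T x y" for x c y
  proof (rule tendsto_unique[OF nontriv lim])
    show "((\<lambda>i. B i x (smul c y)) \<longlongrightarrow> c * ?T x y) \<UU>"
      using tendsto_mult_left[OF lim[of x y], of c]
      by (simp add: module_hom.scale[OF Vector_Spaces.linear.axioms(3)[OF lin]])
  qed
  have vs: "vector_space smul" "vector_space ((*) :: 'k \<Rightarrow> _)"
    using lin by (auto simp: Vector_Spaces.linear_def)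
  have T1: "Vector_Spaces.linear smul (*) (?T x)" for x
    using vs add mult
    by (intro Vector_Spaces.linear.intro module_hom.intro module_hom_axioms.intro)
       (simp_all only: module_iff_vector_space)
  moreover have "(\<lambda>x. ?T x y) = ?T y" for y
    using Tsym by blast
  ultimately show ?thesis
    unfolding inner_product_def using Tsym by simp
qed

end

theory Submission
  imports Defs
begin

text \<open>
  By boundedness the associated inner product is a pointwise limit: \<open>standard_form \<UU> B x y\<close> is the
  limit of \<open>B i x y\<close> along the ultrafilter \<open>\<UU>\<close> (\<open>tendsto_standard_form\<close>).  The claims about its
  radical and about its orthogonal bases follow from uniqueness of limits: a vector is negligible iff
  all the limits \<open>lim B i x y\<close> vanish, and a limit of zeros is zero
  (\<open>form_radical_standard_form\<close>, \<open>orthogonal_wrt_standard_form\<close>).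

  For the nondegeneracy of the enlarged family, the associated inner product \<open>T\<close> itself is taken as
  the distinguished element.  Let \<open>S\<close> be a basis that is orthogonal for \<open>T\<close> and for another inner
  product \<open>C\<close>.  Since \<open>T\<close> has zero radical, \<open>T v v \<noteq> 0\<close> for \<open>v \<in> S\<close>, so the \<open>v\<close>-coordinate of \<open>y\<close> is
  \<open>T v y / T v v\<close>, and \<open>C v y\<close> is \<open>C v v\<close> times this coordinate.  Hence \<open>T v y = 0\<close> implies
  \<open>C v y = 0\<close>.  A vector \<open>x\<close> involves only finitely many elements of \<open>S\<close>, so \<open>C x\<close> vanishes on
  the intersection of finitely many \<open>T\<close>-orthogonal complements, and that is continuity of the linear
  functional \<open>C x\<close> into the discrete field.
\<close>

lemma inner_product_commute: "inner_product smul C \<Longrightarrow> C x y = C y x"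
  by (simp add: inner_product_def)

lemma inner_product_module_hom: "inner_product smul C \<Longrightarrow> module_hom smul (*) (C x)"
  by (simp add: inner_product_def Vector_Spaces.linear.axioms(3))

lemma inner_product_left_simps:
  assumes "inner_product smul C"
  shows "C 0 y = 0" "C (x + z) y = C x y + C z y" "C (smul a x) y = a * C x y"
  using module_hom.zero[OF inner_product_module_hom[OF assms]]
    module_hom.add[OF inner_product_module_hom[OF assms]]
    module_hom.scale[OF inner_product_module_hom[OF assms]]
  by (simp_all only: inner_product_commute[OF assms, of _ y])

text \<open>A diagonal form sees only the \<open>v\<close>-coordinate of \<open>y\<close> when it is paired with a basis vector \<open>v\<close>,
  so two forms that are diagonal in the same basis give proportional functionals \<open>C v\<close> and \<open>T v\<close>.
  The cross-multiplied form also covers \<open>T v v = 0\<close>.\<close>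

lemma orthogonal_basis_functionals_proportional:
  assumes vs: "vector_space smul" and T: "inner_product smul T" and C: "inner_product smul C"
    and S: "is_basis smul S" and orth: "orthogonal_wrt T S" "orthogonal_wrt C S" and v: "v \<in> S"
  shows "T v v * C v y = C v v * T v y"
proof -
  interpret vector_space smul by fact
  note hom = inner_product_module_hom[OF T] inner_product_module_hom[OF C]
  have "y \<in> span S" using S by (simp add: is_basis_def)
  then show ?thesis
  proof (rule span_induct)
    show "subspace {y. T v v * C v y = C v v * T v y}"
      by (rule subspaceI)
        (simp_all add: hom[THEN module_hom.zero] hom[THEN module_hom.add] hom[THEN module_hom.scale]
          distrib_left mult.left_commute)
  next
    fix w assume "w \<in> S"
    then show "T v v * C v w = C v v * T v w"
      using orth v by (cases "v = w") (simp_all add: orthogonal_wrt_def mult.commute)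
  qed
qed

text \<open>An isotropic element of an orthogonal basis would be orthogonal to the whole basis, hence lie in
  the radical.\<close>

lemma orthogonal_basis_not_isotropic:
  assumes vs: "vector_space smul" and T: "inner_product smul T" and nd: "nondegenerate T"
    and S: "is_basis smul S" and orth: "orthogonal_wrt T S" and v: "v \<in> S"
  shows "T v v \<noteq> 0"
proof
  interpret vector_space smul by fact
  assume 0: "T v v = 0"
  note hom = inner_product_module_hom[OF T]
  have "T v y = 0" for y
  proof -
    have "y \<in> span S" using S by (simp add: is_basis_def)
    then show ?thesis
    proof (rule span_induct)
      show "subspace {y. T v y = 0}"
        by (rule subspaceI)
          (simp_all add: hom[THEN module_hom.zero] hom[THEN module_hom.add] hom[THEN module_hom.scale])
    next
      fix w assume "w \<in> S"
      then show "T v w = 0" using 0 orth v by (cases "v = w") (simp_all add: orthogonal_wrt_def)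
    qed
  qed
  then have "v = 0" using nd by (auto simp: nondegenerate_def form_radical_def)
  with v S show False using dependent_zero by (simp add: is_basis_def)
qed

text \<open>An additive map into a discrete monoid is continuous as soon as its kernel contains a basic
  neighborhood of zero: it is then constant on every translate of that neighborhood.\<close>

lemma continuous_map_form_topology:
  assumes add: "\<And>x y. f (x + y) = f x + (f y :: 'a::monoid_add)"
    and fin: "finite A" and ker: "\<And>y. \<forall>v\<in>A. T y v = 0 \<Longrightarrow> f y = 0"
  shows "continuous_map (form_topology T) (discrete_topology UNIV) f"
proof -
  have "openin (form_topology T) {x. f x \<in> U}" for U
    unfolding openin_form_topology
  proof
    fix x assume "x \<in> {x. f x \<in> U}"
    then have "(+) x ` (\<Inter>v\<in>A. orth_complement T v) \<subseteq> {x. f x \<in> U}"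
      by (auto simp: add ker orth_complement_def)
    with fin show "\<exists>A. finite A \<and> (+) x ` (\<Inter>v\<in>A. orth_complement T v) \<subseteq> {x. f x \<in> U}"
      by blast
  qed
  moreover from this[of UNIV] have "topspace (form_topology T) = UNIV"
    using openin_subset by fastforce
  ultimately show ?thesis by (simp add: continuous_map_def)
qed

text \<open>The kernel condition of the continuity criterion holds on basis vectors with \<open>A = {v}\<close>, and the
  vectors for which some finite \<open>A\<close> works form a subspace.\<close>

lemma partially_continuous_orthogonal_basis:
  assumes vs: "vector_space smul" and T: "inner_product smul T" and nd: "nondegenerate T"
    and C: "inner_product smul C"
    and S: "is_basis smul S" and orth: "orthogonal_wrt T S" "orthogonal_wrt C S"
  shows "partially_continuous (form_topology T) (discrete_topology UNIV) C"
proof -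
  interpret vector_space smul by fact
  define P where "P x A \<longleftrightarrow> (\<forall>y. (\<forall>v\<in>A. T y v = 0) \<longrightarrow> C x y = 0)" for x A
  have ker: "\<exists>A. finite A \<and> P x A" for x
  proof -
    have "x \<in> span S" using S by (simp add: is_basis_def)
    then show ?thesis
    proof (rule span_induct)
      show "subspace {x. \<exists>A. finite A \<and> P x A}"
      proof (rule subspaceI)
        show "0 \<in> {x. \<exists>A. finite A \<and> P x A}"
          by (auto simp: P_def inner_product_left_simps[OF C])
      next
        fix x z assume "x \<in> {x. \<exists>A. finite A \<and> P x A}" "z \<in> {x. \<exists>A. finite A \<and> P x A}"
        then obtain A A' where "finite A" "P x A" "finite A'" "P z A'" by blast
        then have "finite (A \<union> A') \<and> P (x + z) (A \<union> A')"
          by (simp add: P_def inner_product_left_simps[OF C])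
        then show "x + z \<in> {x. \<exists>A. finite A \<and> P x A}" by blast
      next
        fix c x assume "x \<in> {x. \<exists>A. finite A \<and> P x A}"
        then show "smul c x \<in> {x. \<exists>A. finite A \<and> P x A}"
          by (auto simp: P_def inner_product_left_simps[OF C])
      qed
    next
      fix v assume v: "v \<in> S"
      have "P v {v}"
        using orthogonal_basis_functionals_proportional[OF vs T C S orth v]
          orthogonal_basis_not_isotropic[OF vs T nd S orth(1) v]
        inner_product_commute[OF T]
        unfolding P_def by (metis mult_eq_0_iff mult_zero_right singletonI)
      then show "\<exists>A. finite A \<and> P v A" by blast
    qed
  qed
  have "continuous_map (form_topology T) (discrete_topology UNIV) (C x)" for x
  proof -
    obtain A where "finite A" "P x A" using ker by blast
    then show ?thesis
      using continuous_map_form_topology[of "C x" A T, OF module_hom.add[OF inner_product_module_hom[OF C]]]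
      unfolding P_def by blast
  qed
  moreover have "(\<lambda>y. C y x) = C x" for x
    using inner_product_commute[OF C] by blast
  ultimately show ?thesis by (simp add: partially_continuous_def)
qed

lemma form_radical_standard_form:
  fixes B :: "'i \<Rightarrow> 'v \<Rightarrow> 'v \<Rightarrow> 'k::real_or_complex"
  assumes U: "ultrafilter \<UU>" and bdd: "bounded_family \<UU> B"
  shows "form_radical (standard_form \<UU> B) = neg_elements \<UU> B"
proof -
  have "\<UU> \<noteq> bot" using U by (simp add: ultrafilter_def)
  then have "standard_form \<UU> B x y = 0 \<longleftrightarrow> ((\<lambda>i. B i x y) \<longlongrightarrow> 0) \<UU>" for x y
    using tendsto_standard_form[OF U bdd, of x y] by (metis tendsto_unique)
  then show ?thesis by (simp add: form_radical_def neg_elements_def tendsto_iff)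
qed

lemma orthogonal_wrt_standard_form:
  fixes B :: "'i \<Rightarrow> 'v \<Rightarrow> 'v \<Rightarrow> 'k::real_or_complex"
  assumes U: "ultrafilter \<UU>" and bdd: "bounded_family \<UU> B" and orth: "\<And>i. orthogonal_wrt (B i) S"
  shows "orthogonal_wrt (standard_form \<UU> B) S"
  unfolding orthogonal_wrt_def
proof (intro ballI impI)
  fix v w assume "v \<in> S" "w \<in> S" "v \<noteq> w"
  then have "((\<lambda>i. B i v w) \<longlongrightarrow> 0) \<UU>" using orth by (simp add: orthogonal_wrt_def)
  moreover have "\<UU> \<noteq> bot" using U by (simp add: ultrafilter_def)
  ultimately show "standard_form \<UU> B v w = 0"
    using tendsto_standard_form[OF U bdd] tendsto_unique by blast
qed

theorem theorem4:
  fixes smul :: "'k::real_or_complex \<Rightarrow> 'v::ab_group_add \<Rightarrow> 'v"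
    and le :: "'i \<Rightarrow> 'i \<Rightarrow> bool"
    and \<UU> :: "'i filter"
    and B :: "'i \<Rightarrow> 'v \<Rightarrow> 'v \<Rightarrow> 'k"
  assumes "vector_space smul"
    and "directed_preorder le"
    and "ultrafilter \<UU>"
    and "\<And>i. eventually (\<lambda>j. le i j) \<UU>"
    and "\<And>i. inner_product smul (B i)"
    and "bounded_family \<UU> B"
  shows "form_radical (standard_form \<UU> B) = neg_elements \<UU> B \<and>
    (robust_family \<UU> B \<longrightarrow> nondegenerate (standard_form \<UU> B)) \<and>
    (simultaneously_orthogonalizable smul (range B) \<longleftrightarrow>
       simultaneously_orthogonalizable smul (range B \<union> {standard_form \<UU> B})) \<and>
    (robust_family \<UU> B \<and> simultaneously_orthogonalizable smul (range B) \<longrightarrow>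
       nondegenerate_family (range B \<union> {standard_form \<UU> B})) \<and>
    (\<forall>S. is_basis smul S \<longrightarrow>
       ((\<forall>C\<in>range B. orthogonal_wrt C S) \<longleftrightarrow>
        (\<forall>C\<in>range B \<union> {standard_form \<UU> B}. orthogonal_wrt C S)))"
proof -
  let ?T = "standard_form \<UU> B"
  note vs = assms(1) and U = assms(3) and ip = assms(5) and bdd = assms(6)
  have T: "inner_product smul ?T" by (rule inner_product_standard_form[OF U bdd ip])
  have rad: "form_radical ?T = neg_elements \<UU> B" by (rule form_radical_standard_form[OF U bdd])
  then have robust: "nondegenerate ?T" if "robust_family \<UU> B"
    using that by (simp add: robust_family_def nondegenerate_def)
  have orth: "(\<forall>C\<in>range B. orthogonal_wrt C S) \<longleftrightarrow>
      (\<forall>C\<in>range B \<union> {?T}. orthogonal_wrt C S)" for S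
    using orthogonal_wrt_standard_form[OF U bdd] by auto
  have nd: "nondegenerate_family (range B \<union> {?T})"
    if r: "robust_family \<UU> B" and so: "simultaneously_orthogonalizable smul (range B)"
  proof -
    obtain S where S: "is_basis smul S" and S_orth: "\<forall>C\<in>range B \<union> {?T}. orthogonal_wrt C S"
      using so unfolding simultaneously_orthogonalizable_def orth by blast
    have "partially_continuous (form_topology ?T) (discrete_topology UNIV) C"
      if "C \<in> range B \<union> {?T}" for C
      using partially_continuous_orthogonal_basis[OF vs T robust[OF r] _ S] S_orth that T ip by blast
    with robust[OF r] show ?thesis unfolding nondegenerate_family_def by blast
  qed
  have "simultaneously_orthogonalizable smul (range B) \<longleftrightarrow>
      simultaneously_orthogonalizable smul (range B \<union> {?T})"
    unfolding simultaneously_orthogonalizable_def orth ..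
  with rad robust nd orth show ?thesis by blast
qed

end
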